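(* Let $r(t)$ be a real-valued continuous function on $[t_0,+\infty)$. If the equation $\phi''+r(t)\phi=0$, $t\ge t_0$, is Lyapunov stable, then for every nontrivial solution $\phi(t)$ of it there exist positive numbers $r_\phi<R_\phi$ such that $$r_\phi\le\sqrt{\phi^2(t)+\phi'(t)^2}\le R_\phi,\qquad t\ge t_0.$$
   Context: All solutions are real-valued. A linear system is called Lyapunov stable if all its solutions are bounded on $[t_0,+\infty)$; the equation $\phi''+r(t)\phi=0$ is identified with the system $\phi'=\psi$, $\psi'=-r(t)\phi$, so it is Lyapunov stable if for every solution $\phi$ both $\phi$ and $\phi'$ are bounded on $[t_0,+\infty)$. *)

theory Defs
  imports "HOL-Analysis.Analysis"
begin

(* A solution of phi'' + r phi = 0 on [t0, oo) is carried together with its derivative psi = phi',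
   which is uniquely determined on [t0, oo).  Derivatives are taken within {t0..}, hence
   one-sided at t0; values outside {t0..} are irrelevant. *)
definition solves_eq :: "real \<Rightarrow> (real \<Rightarrow> real) \<Rightarrow> (real \<Rightarrow> real) \<Rightarrow> (real \<Rightarrow> real) \<Rightarrow> bool" where
  "solves_eq t0 r \<phi> \<psi> \<longleftrightarrow>
     (\<forall>t\<ge>t0. (\<phi> has_real_derivative \<psi> t) (at t within {t0..}) \<and>
             (\<psi> has_real_derivative - r t * \<phi> t) (at t within {t0..}))"

definition lyapunov_stable_eq :: "real \<Rightarrow> (real \<Rightarrow> real) \<Rightarrow> bool" where
  "lyapunov_stable_eq t0 r \<longleftrightarrow>
     (\<forall>\<phi> \<psi>. solves_eq t0 r \<phi> \<psi> \<longrightarrow> bounded (\<phi> ` {t0..}) \<and> bounded (\<psi> ` {t0..}))"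

end

theory Submission
  imports Defs
begin

text \<open>
  The upper bound is stability itself.  For the lower bound it is enough to have a companion
  solution \<open>(u, v)\<close> whose Wronskian \<open>\<phi> v - \<psi> u\<close> with the given solution \<open>(\<phi>, \<psi>)\<close> is \<open>1\<close>: stability
  bounds \<open>(u, v)\<close>, so \<open>(\<phi>, \<psi>)\<close> cannot come close to \<open>0\<close> without the Wronskian doing so
  (\<open>wronskian_one_lower_bound\<close>).

  The companion is obtained by reduction of order, applied to the first-order system so that zeros
  of \<open>\<phi>\<close> do no harm.  Write \<open>N = \<phi>\<^sup>2 + \<psi>\<^sup>2\<close>.  The solutions of the planar system having Wronskian
  \<open>1\<close> with \<open>(\<phi>, \<psi>)\<close> must be of the form \<open>a (\<phi>, \<psi>) + (1 / N) (-\<psi>, \<phi>)\<close>, and substituting this into the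
  system leaves the single condition \<open>a' = (1 - r) (\<phi>\<^sup>2 - \<psi>\<^sup>2) / N\<^sup>2\<close> on the scalar \<open>a\<close>.  Existence of
  the companion thus needs only an antiderivative of a continuous function
  (\<open>companion_solution_exists\<close>).

  The construction divides by \<open>N\<close>, so it relies on the fact that a solution vanishing together with
  its derivative at one point vanishes identically (\<open>solves_eq_nonvanishing\<close>).  This is a Gronwall
  argument based on \<open>\<bar>N'\<bar> \<le> \<bar>1 - r\<bar> N\<close>.
\<close>

lemma continuous_on_atLeast_antiderivative:
  fixes f :: "real \<Rightarrow> real"
  assumes "continuous_on {a..} f"
  shows "\<exists>F. \<forall>t\<ge>a. (F has_real_derivative f t) (at t within {a..})"
proof (intro exI allI impI)
  fix t assume t: "a \<le> t"
  have "continuous_on {a..t+1} f"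
    using assms by (rule continuous_on_subset) auto
  then have "((\<lambda>x. integral {a..x} f) has_real_derivative f t) (at t within {a..t+1})"
    using t by (intro integral_has_real_derivative) auto
  moreover have "at t within {a..t+1} = at t within {a..}"
    by (rule at_within_nhd[of _ "{..<t+1}"]) auto
  ultimately show "((\<lambda>x. integral {a..x} f) has_real_derivative f t) (at t within {a..})"
    by simp
qed

lemma nonneg_derivative_within_atLeast_mono:
  fixes f f' :: "real \<Rightarrow> real"
  assumes deriv: "\<And>t. t \<ge> a \<Longrightarrow> (f has_real_derivative f' t) (at t within {a..})"
    and nonneg: "\<And>t. t \<ge> a \<Longrightarrow> 0 \<le> f' t"
    and "a \<le> s" "s \<le> t"
  shows "f s \<le> f t"
proof (rule DERIV_nonneg_imp_increasing_open[OF \<open>s \<le> t\<close>])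
  fix x assume "s < x" "x < t"
  then have "x \<in> interior {a..}"
    using \<open>a \<le> s\<close> by simp
  then have "DERIV f x :> f' x"
    using deriv[of x] by (metis at_within_interior interior_subset subsetD atLeast_iff)
  then show "\<exists>y. DERIV f x :> y \<and> 0 \<le> y"
    using nonneg[of x] \<open>a \<le> s\<close> \<open>s < x\<close> by auto
next
  have "continuous_on {a..} f"
    by (rule DERIV_continuous_on[of _ _ f']) (simp add: deriv)
  then show "continuous_on {s..t} f"
    by (rule continuous_on_subset) (use \<open>a \<le> s\<close> in auto)
qed

text \<open>
  Gronwall in both time directions: if \<open>K' = k\<close>, then \<open>N exp K\<close> is nondecreasing and \<open>N exp (-K)\<close> is
  nonincreasing, so a zero of \<open>N\<close> propagates to the left by the first and to the right by the second.
\<close>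

lemma vanishing_propagates:
  fixes N N' k :: "real \<Rightarrow> real"
  assumes deriv: "\<And>t. t \<ge> a \<Longrightarrow> (N has_real_derivative N' t) (at t within {a..})"
    and bound: "\<And>t. t \<ge> a \<Longrightarrow> \<bar>N' t\<bar> \<le> k t * N t"
    and nonneg: "\<And>t. t \<ge> a \<Longrightarrow> 0 \<le> N t"
    and k: "continuous_on {a..} k"
    and s: "a \<le> s" "N s = 0" and t: "a \<le> t"
  shows "N t = 0"
proof -
  obtain K where K: "\<And>t. a \<le> t \<Longrightarrow> (K has_real_derivative k t) (at t within {a..})"
    using continuous_on_atLeast_antiderivative[OF k] by blast
  have "N t \<le> 0"
  proof (cases "t \<le> s")
    case True
    have "N t * exp (K t) \<le> N s * exp (K s)"
    proof (rule nonneg_derivative_within_atLeast_mono[where f = "\<lambda>x. N x * exp (K x)"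
             and f' = "\<lambda>x. (N' x + k x * N x) * exp (K x)"])
      fix x assume x: "a \<le> x"
      show "((\<lambda>x. N x * exp (K x)) has_real_derivative (N' x + k x * N x) * exp (K x))
              (at x within {a..})"
        by (rule derivative_eq_intros deriv[OF x] K[OF x] refl | simp add: algebra_simps)+
      show "0 \<le> (N' x + k x * N x) * exp (K x)"
        using bound[OF x] by (intro mult_nonneg_nonneg) auto
    qed (use t True in auto)
    then show ?thesis
      using s by (simp add: mult_le_0_iff)
  next
    case False
    have "- (N s * exp (- K s)) \<le> - (N t * exp (- K t))"
    proof (rule nonneg_derivative_within_atLeast_mono[where f = "\<lambda>x. - (N x * exp (- K x))"
             and f' = "\<lambda>x. (k x * N x - N' x) * exp (- K x)"])
      fix x assume x: "a \<le> x"
      show "((\<lambda>x. - (N x * exp (- K x))) has_real_derivative (k x * N x - N' x) * exp (- K x))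
              (at x within {a..})"
        by (rule derivative_eq_intros deriv[OF x] K[OF x] refl | simp add: algebra_simps)+
      show "0 \<le> (k x * N x - N' x) * exp (- K x)"
        using bound[OF x] by (intro mult_nonneg_nonneg) auto
    qed (use s False in auto)
    then show ?thesis
      using s by (simp add: mult_le_0_iff)
  qed
  then show ?thesis
    using nonneg[OF t] by simp
qed

lemma solves_eq_norm_derivative:
  assumes "solves_eq t0 r \<phi> \<psi>" "t0 \<le> t"
  shows "((\<lambda>t. (\<phi> t)\<^sup>2 + (\<psi> t)\<^sup>2) has_real_derivative 2 * (1 - r t) * (\<phi> t * \<psi> t))
           (at t within {t0..})"
proof -
  have d: "(\<phi> has_real_derivative \<psi> t) (at t within {t0..})"
    "(\<psi> has_real_derivative - r t * \<phi> t) (at t within {t0..})"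
    using assms by (auto simp: solves_eq_def)
  show ?thesis
    by (rule derivative_eq_intros d refl | simp add: algebra_simps)+
qed

lemma solves_eq_nonvanishing:
  assumes r: "continuous_on {t0..} r"
    and sol: "solves_eq t0 r \<phi> \<psi>"
    and nontrivial: "t0 \<le> t1" "\<phi> t1 \<noteq> 0"
    and t: "t0 \<le> t"
  shows "0 < (\<phi> t)\<^sup>2 + (\<psi> t)\<^sup>2"
proof (rule ccontr)
  assume "\<not> 0 < (\<phi> t)\<^sup>2 + (\<psi> t)\<^sup>2"
  then have zero: "(\<phi> t)\<^sup>2 + (\<psi> t)\<^sup>2 = 0"
    by (smt (verit) zero_le_power2)
  have "\<bar>2 * (1 - r x) * (\<phi> x * \<psi> x)\<bar> \<le> \<bar>1 - r x\<bar> * ((\<phi> x)\<^sup>2 + (\<psi> x)\<^sup>2)" for x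
  proof -
    have "2 * \<bar>\<phi> x * \<psi> x\<bar> \<le> (\<phi> x)\<^sup>2 + (\<psi> x)\<^sup>2"
      using sum_squares_bound[of "\<bar>\<phi> x\<bar>" "\<bar>\<psi> x\<bar>"] by (simp add: abs_mult)
    then have "\<bar>1 - r x\<bar> * (2 * \<bar>\<phi> x * \<psi> x\<bar>) \<le> \<bar>1 - r x\<bar> * ((\<phi> x)\<^sup>2 + (\<psi> x)\<^sup>2)"
      by (rule mult_left_mono) simp
    moreover have "\<bar>2 * (1 - r x) * (\<phi> x * \<psi> x)\<bar> = \<bar>1 - r x\<bar> * (2 * \<bar>\<phi> x * \<psi> x\<bar>)"
      by (simp only: abs_mult abs_numeral mult_ac)
    ultimately show ?thesis
      by simp
  qed
  then have "(\<phi> t1)\<^sup>2 + (\<psi> t1)\<^sup>2 = 0"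
    by (intro vanishing_propagates[OF solves_eq_norm_derivative[OF sol],
          where k = "\<lambda>x. \<bar>1 - r x\<bar>" and s = t and t = t1])
      (use r nontrivial t zero in \<open>auto intro!: continuous_intros\<close>)
  then show False
    using nontrivial by (simp add: sum_power2_eq_zero_iff)
qed

text \<open>
  Reduction of order for the planar system.  The vector \<open>(-\<psi>, \<phi>) / N\<close> supplies the Wronskian, and
  the multiple \<open>a\<close> of \<open>(\<phi>, \<psi>)\<close> corrects it to a solution: both equations of the system reduce to the
  same formula for \<open>a'\<close>.
\<close>

lemma companion_solution_exists:
  assumes r: "continuous_on {t0..} r"
    and sol: "solves_eq t0 r \<phi> \<psi>"
    and nonzero: "\<And>t. t0 \<le> t \<Longrightarrow> (\<phi> t)\<^sup>2 + (\<psi> t)\<^sup>2 \<noteq> 0"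
  shows "\<exists>u v. solves_eq t0 r u v \<and> (\<forall>t\<ge>t0. \<phi> t * v t - \<psi> t * u t = 1)"
proof -
  define N where "N = (\<lambda>t. (\<phi> t)\<^sup>2 + (\<psi> t)\<^sup>2)"
  have N: "N t \<noteq> 0" if "t0 \<le> t" for t
    using nonzero[OF that] by (simp add: N_def)
  have d\<phi>: "(\<phi> has_real_derivative \<psi> t) (at t within {t0..})"
    and d\<psi>: "(\<psi> has_real_derivative - r t * \<phi> t) (at t within {t0..})" if "t0 \<le> t" for t
    using sol that by (auto simp: solves_eq_def)
  have dN: "(N has_real_derivative 2 * (1 - r t) * (\<phi> t * \<psi> t)) (at t within {t0..})"
    if "t0 \<le> t" for t
    unfolding N_def using solves_eq_norm_derivative[OF sol that] .
  have "continuous_on {t0..} \<phi>"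
    by (rule DERIV_continuous_on[where D = \<psi>]) (simp add: d\<phi>)
  moreover have "continuous_on {t0..} \<psi>"
    by (rule DERIV_continuous_on[where D = "\<lambda>t. - r t * \<phi> t"]) (use d\<psi> in simp)
  moreover have "continuous_on {t0..} N"
    by (rule DERIV_continuous_on[where D = "\<lambda>t. 2 * (1 - r t) * (\<phi> t * \<psi> t)"]) (use dN in simp)
  ultimately have "continuous_on {t0..} (\<lambda>t. (1 - r t) * ((\<phi> t)\<^sup>2 - (\<psi> t)\<^sup>2) / (N t)\<^sup>2)"
    using r N by (intro continuous_intros) auto
  then obtain a where a: "\<And>t. t0 \<le> t \<Longrightarrow> (a has_real_derivative
      (1 - r t) * ((\<phi> t)\<^sup>2 - (\<psi> t)\<^sup>2) / (N t)\<^sup>2) (at t within {t0..})"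
    using continuous_on_atLeast_antiderivative by blast
  define u where "u = (\<lambda>t. a t * \<phi> t - \<psi> t / N t)"
  define v where "v = (\<lambda>t. a t * \<psi> t + \<phi> t / N t)"
  have "solves_eq t0 r u v"
    unfolding solves_eq_def
  proof (intro allI impI conjI)
    fix t assume t: "t0 \<le> t"
    note derivs = a[OF t] d\<phi>[OF t] d\<psi>[OF t] dN[OF t]
    have "((1 - r t) * ((\<phi> t)\<^sup>2 - (\<psi> t)\<^sup>2) / (N t)\<^sup>2) * \<phi> t + \<psi> t * a t
            - ((- r t * \<phi> t) * N t - \<psi> t * (2 * (1 - r t) * (\<phi> t * \<psi> t))) / (N t * N t) = v t"
      using N[OF t] unfolding v_def
      apply (simp add: divide_simps power2_eq_square)
      apply (simp add: N_def power2_eq_square algebra_simps)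
      done
    moreover have "(u has_real_derivative
        ((1 - r t) * ((\<phi> t)\<^sup>2 - (\<psi> t)\<^sup>2) / (N t)\<^sup>2) * \<phi> t + \<psi> t * a t
          - ((- r t * \<phi> t) * N t - \<psi> t * (2 * (1 - r t) * (\<phi> t * \<psi> t))) / (N t * N t))
        (at t within {t0..})"
      unfolding u_def by (intro DERIV_diff DERIV_mult DERIV_divide derivs N[OF t])
    ultimately show "(u has_real_derivative v t) (at t within {t0..})"
      by simp
    have "((1 - r t) * ((\<phi> t)\<^sup>2 - (\<psi> t)\<^sup>2) / (N t)\<^sup>2) * \<psi> t + (- r t * \<phi> t) * a t
            + (\<psi> t * N t - \<phi> t * (2 * (1 - r t) * (\<phi> t * \<psi> t))) / (N t * N t) = - r t * u t"
      using N[OF t] unfolding u_def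
      apply (simp add: divide_simps power2_eq_square)
      apply (simp add: N_def power2_eq_square algebra_simps)
      done
    moreover have "(v has_real_derivative
        ((1 - r t) * ((\<phi> t)\<^sup>2 - (\<psi> t)\<^sup>2) / (N t)\<^sup>2) * \<psi> t + (- r t * \<phi> t) * a t
          + (\<psi> t * N t - \<phi> t * (2 * (1 - r t) * (\<phi> t * \<psi> t))) / (N t * N t))
        (at t within {t0..})"
      unfolding v_def by (intro DERIV_add DERIV_mult DERIV_divide derivs N[OF t])
    ultimately show "(v has_real_derivative - r t * u t) (at t within {t0..})"
      by simp
  qed
  moreover have "\<phi> t * v t - \<psi> t * u t = 1" if "t0 \<le> t" for t
  proof -
    have "\<phi> t * v t - \<psi> t * u t = ((\<phi> t)\<^sup>2 + (\<psi> t)\<^sup>2) / N t"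
      by (simp add: u_def v_def power2_eq_square algebra_simps add_divide_distrib)
    then show ?thesis
      using N[OF that] by (simp add: N_def)
  qed
  ultimately show ?thesis
    by blast
qed

lemma wronskian_one_lower_bound:
  fixes x y u v B C :: real
  assumes "x * v - y * u = 1" "\<bar>u\<bar> \<le> B" "\<bar>v\<bar> \<le> C"
  shows "1 \<le> sqrt (x\<^sup>2 + y\<^sup>2) * (B + C)"
proof -
  have "1 = \<bar>x * v - y * u\<bar>"
    using assms by simp
  also have "\<dots> \<le> \<bar>x\<bar> * \<bar>v\<bar> + \<bar>y\<bar> * \<bar>u\<bar>"
    by (metis abs_mult abs_triangle_ineq4)
  also have "\<dots> \<le> sqrt (x\<^sup>2 + y\<^sup>2) * C + sqrt (x\<^sup>2 + y\<^sup>2) * B"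
    using assms by (intro add_mono mult_mono) (auto intro: real_le_rsqrt)
  finally show ?thesis
    by (simp add: algebra_simps)
qed

lemma lyapunov_stable_eqE:
  assumes "lyapunov_stable_eq t0 r" "solves_eq t0 r \<phi> \<psi>"
  obtains B C where "0 < B" "0 < C" "\<And>t. t0 \<le> t \<Longrightarrow> \<bar>\<phi> t\<bar> \<le> B" "\<And>t. t0 \<le> t \<Longrightarrow> \<bar>\<psi> t\<bar> \<le> C"
proof -
  have "bounded (\<phi> ` {t0..})" "bounded (\<psi> ` {t0..})"
    using assms by (auto simp: lyapunov_stable_eq_def)
  then show ?thesis
    using that by (auto simp: bounded_pos)
qed

theorem mainTheorem4:
  fixes t0 :: real and r :: "real \<Rightarrow> real"
  assumes "continuous_on {t0..} r"
    and "lyapunov_stable_eq t0 r"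
  shows "\<forall>\<phi> \<phi>'. solves_eq t0 r \<phi> \<phi>' \<and> (\<exists>t\<ge>t0. \<phi> t \<noteq> 0) \<longrightarrow>
           (\<exists>r\<^sub>\<phi> R\<^sub>\<phi>. 0 < r\<^sub>\<phi> \<and> r\<^sub>\<phi> < R\<^sub>\<phi> \<and>
              (\<forall>t\<ge>t0. r\<^sub>\<phi> \<le> sqrt ((\<phi> t)\<^sup>2 + (\<phi>' t)\<^sup>2) \<and>
                      sqrt ((\<phi> t)\<^sup>2 + (\<phi>' t)\<^sup>2) \<le> R\<^sub>\<phi>))"
proof (intro allI impI, elim conjE exE)
  fix \<phi> \<psi> t1
  assume sol: "solves_eq t0 r \<phi> \<psi>" and t1: "t0 \<le> t1" "\<phi> t1 \<noteq> 0"
  obtain u v where uv: "solves_eq t0 r u v"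
    and wronskian: "\<And>t. t0 \<le> t \<Longrightarrow> \<phi> t * v t - \<psi> t * u t = 1"
    using companion_solution_exists[OF assms(1) sol] solves_eq_nonvanishing[OF assms(1) sol t1]
    by (metis less_irrefl)
  obtain B C where BC: "0 < B" "0 < C"
    "\<And>t. t0 \<le> t \<Longrightarrow> \<bar>\<phi> t\<bar> \<le> B" "\<And>t. t0 \<le> t \<Longrightarrow> \<bar>\<psi> t\<bar> \<le> C"
    using lyapunov_stable_eqE[OF assms(2) sol] by blast
  obtain D E where DE: "0 < D" "0 < E"
    "\<And>t. t0 \<le> t \<Longrightarrow> \<bar>u t\<bar> \<le> D" "\<And>t. t0 \<le> t \<Longrightarrow> \<bar>v t\<bar> \<le> E"
    using lyapunov_stable_eqE[OF assms(2) uv] by blast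
  have lower: "1 / (D + E) \<le> sqrt ((\<phi> t)\<^sup>2 + (\<psi> t)\<^sup>2)" if "t0 \<le> t" for t
    using wronskian_one_lower_bound[OF wronskian[OF that] DE(3)[OF that] DE(4)[OF that]] DE(1,2)
    by (simp add: divide_le_eq)
  have upper: "sqrt ((\<phi> t)\<^sup>2 + (\<psi> t)\<^sup>2) \<le> B + C" if "t0 \<le> t" for t
    using sqrt_sum_squares_le_sum_abs[of "\<phi> t" "\<psi> t"] BC(3,4)[OF that] by linarith
  \<comment> \<open>The summand \<open>1 / (D + E)\<close> in the upper bound makes it strictly larger than the lower one.\<close>
  show "\<exists>\<rho> R. 0 < \<rho> \<and> \<rho> < R \<and> (\<forall>t\<ge>t0. \<rho> \<le> sqrt ((\<phi> t)\<^sup>2 + (\<psi> t)\<^sup>2) \<and>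
          sqrt ((\<phi> t)\<^sup>2 + (\<psi> t)\<^sup>2) \<le> R)"
  proof (intro exI conjI allI impI)
    show "0 < 1 / (D + E)" "1 / (D + E) < B + C + 1 / (D + E)"
      using BC(1,2) DE(1,2) by simp_all
    fix t assume t: "t0 \<le> t"
    show "1 / (D + E) \<le> sqrt ((\<phi> t)\<^sup>2 + (\<psi> t)\<^sup>2)"
      by (rule lower[OF t])
    show "sqrt ((\<phi> t)\<^sup>2 + (\<psi> t)\<^sup>2) \<le> B + C + 1 / (D + E)"
      using upper[OF t] \<open>0 < 1 / (D + E)\<close> by linarith
  qed
qed

end
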